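(* Let $H$ be a two-dimensional complex Hilbert space, let $a,b \in \mathcal{B}(H)$ commute ($ab=ba$), and let $T_{a,b}\colon \mathcal{B}(H)\to\mathcal{B}(H)$ be given by $T_{a,b}(x) = axb+bxa$. Then $$\left\| T_{a,b} \right\|_{cb} = \left\| T_{a,b} \right\|.$$
   Context: $\mathcal{B}(H)$ denotes the algebra of bounded linear operators on $H$ with the operator norm. $\|T\|$ is the norm of $T$ as a linear operator on $\mathcal{B}(H)$, and $\|T\|_{cb} = \sup_n \|T^{(n)}\|$ is the completely bounded norm, where $T^{(n)}$ applies $T$ entrywise to $n\times n$ matrices over $\mathcal{B}(H)$, with $M_n(\mathcal{B}(H))$ normed as $\mathcal{B}(H^n)$. *)

theory Defs
  imports "HOL-Analysis.Analysis"
begin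

text \<open>The inner product is linear in the first argument. Positive definiteness is not a separate
  axiom: it follows from \<open>cinner_self\<close> and the axioms for the norm.\<close>

class complex_hilbert_space = banach +
  fixes scaleC :: "complex \<Rightarrow> 'a \<Rightarrow> 'a"  (infixr "*\<^sub>C" 75)
    and cinner :: "'a \<Rightarrow> 'a \<Rightarrow> complex"
  assumes scaleC_add_right: "c *\<^sub>C (x + y) = c *\<^sub>C x + c *\<^sub>C y"
    and scaleC_add_left: "(c + d) *\<^sub>C x = c *\<^sub>C x + d *\<^sub>C x"
    and scaleC_scaleC: "c *\<^sub>C d *\<^sub>C x = (c * d) *\<^sub>C x"
    and scaleC_of_real: "complex_of_real r *\<^sub>C x = r *\<^sub>R x"
    and cinner_commute: "cinner x y = cnj (cinner y x)"
    and cinner_add_left: "cinner (x + y) z = cinner x z + cinner y z"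
    and cinner_scaleC_left: "cinner (c *\<^sub>C x) y = c * cinner x y"
    and cinner_self: "cinner x x = complex_of_real ((norm x)\<^sup>2)"

lemma scaleC_one: "1 *\<^sub>C x = (x :: 'a::complex_hilbert_space)"
  using scaleC_of_real[of 1 x] by simp

global_interpretation complex_vector: vector_space "scaleC :: complex \<Rightarrow> 'h \<Rightarrow> 'h::complex_hilbert_space"
  by unfold_locales (simp_all add: scaleC_add_right scaleC_add_left scaleC_scaleC scaleC_one)

instantiation complex :: complex_hilbert_space
begin
definition scaleC_complex :: "complex \<Rightarrow> complex \<Rightarrow> complex" where "scaleC_complex c x = c * x"
definition cinner_complex :: "complex \<Rightarrow> complex \<Rightarrow> complex" where "cinner_complex x y = x * cnj y"
instance
  by standard (auto simp: scaleC_complex_def cinner_complex_def algebra_simps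
      scaleR_conv_of_real complex_norm_square simp del: of_real_power)
end

instantiation vec :: (complex_hilbert_space, finite) complex_hilbert_space
begin
definition scaleC_vec :: "complex \<Rightarrow> 'a ^ 'b \<Rightarrow> 'a ^ 'b"
  where "scaleC_vec c x = (\<chi> i. c *\<^sub>C x $ i)"
definition cinner_vec :: "'a ^ 'b \<Rightarrow> 'a ^ 'b \<Rightarrow> complex"
  where "cinner_vec x y = (\<Sum>i\<in>UNIV. cinner (x $ i) (y $ i))"
instance
proof
  fix x y :: "'a ^ 'b"
  show "cinner x y = cnj (cinner y x)"
    unfolding cinner_vec_def cnj_sum by (intro sum.cong refl cinner_commute)
  show "cinner x x = complex_of_real ((norm x)\<^sup>2)"
    by (simp add: cinner_vec_def norm_vec_def L2_set_def cinner_self sum_nonneg)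
qed (simp_all add: scaleC_vec_def cinner_vec_def vec_eq_iff scaleC_add_right scaleC_add_left
      scaleC_scaleC scaleC_of_real cinner_add_left cinner_scaleC_left sum.distrib sum_distrib_left)
end

lemma dim_complex_2: "complex_vector.dim (UNIV :: (complex ^ 2) set) = 2"
proof -
  let ?B = "{axis 1 1, axis 2 1} :: (complex ^ 2) set"
  have ne: "axis 1 1 \<noteq> (axis 2 1 :: complex ^ 2)"
    by (simp add: axis_eq_axis)
  have "\<not> complex_vector.dependent ?B"
  proof
    assume "complex_vector.dependent ?B"
    then obtain u where u: "\<exists>v\<in>?B. u v \<noteq> 0" "(\<Sum>v\<in>?B. u v *\<^sub>C v) = 0"
      by (subst (asm) complex_vector.dependent_finite) auto
    then have "u (axis 1 1) *\<^sub>C axis 1 1 + u (axis 2 1) *\<^sub>C axis 2 1 = (0 :: complex ^ 2)"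
      using ne by simp
    then have "u (axis 1 1) = 0 \<and> u (axis 2 1) = 0"
      by (simp add: vec_eq_iff forall_2 scaleC_vec_def scaleC_complex_def axis_def)
    with u show False by auto
  qed
  moreover have "x \<in> complex_vector.span ?B" for x
  proof -
    have "x = x $ 1 *\<^sub>C axis 1 1 + x $ 2 *\<^sub>C axis 2 1"
      by (simp add: vec_eq_iff forall_2 scaleC_vec_def scaleC_complex_def axis_def)
    then show ?thesis
      by (metis complex_vector.span_add complex_vector.span_base complex_vector.span_scale insertI1 insertI2)
  qed
  ultimately have "card ?B = complex_vector.dim (UNIV :: (complex ^ 2) set)"
    by (intro complex_vector.basis_card_eq_dim) auto
  then show ?thesis using ne by simp
qed

text \<open>The type \<^typ>\<open>'h \<Rightarrow>\<^sub>L 'h\<close> consists of the real-linear bounded operators; \<open>\<B>(H)\<close> is the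
  subalgebra of the complex-linear ones, with the (same) operator norm.\<close>

definition bounded_ops :: "('h::complex_hilbert_space \<Rightarrow>\<^sub>L 'h) set"
  where "bounded_ops = {x. \<forall>c v. blinfun_apply x (c *\<^sub>C v) = c *\<^sub>C blinfun_apply x v}"

text \<open>The norms below take values in \<^typ>\<open>ennreal\<close>, so that the suprema are meaningful without
  boundedness assumptions.\<close>

definition op_norm :: "(('h::complex_hilbert_space \<Rightarrow>\<^sub>L 'h) \<Rightarrow> ('h \<Rightarrow>\<^sub>L 'h)) \<Rightarrow> ennreal"
  where "op_norm T = (SUP x\<in>{x \<in> bounded_ops. norm x \<le> 1}. ennreal (norm (T x)))"

text \<open>\<open>H\<^sup>n\<close> consists of the functions \<open>\<xi>\<close> on \<open>{..<n}\<close> with the Hilbert space norm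
  \<open>L2_set (\<lambda>i. norm (\<xi> i)) {..<n}\<close>, and an \<open>n\<times>n\<close> matrix of operators acts on it by
  \<open>(X \<xi>) i = (\<Sum>j<n. X i j (\<xi> j))\<close>. Values at indices \<open>\<ge> n\<close> are irrelevant.\<close>

definition matrix_norm :: "nat \<Rightarrow> (nat \<Rightarrow> nat \<Rightarrow> 'h::complex_hilbert_space \<Rightarrow>\<^sub>L 'h) \<Rightarrow> ennreal"
  where "matrix_norm n X =
    (SUP \<xi>\<in>{\<xi>. L2_set (\<lambda>j. norm (\<xi> j)) {..<n} \<le> 1}.
       ennreal (L2_set (\<lambda>i. norm (\<Sum>j<n. blinfun_apply (X i j) (\<xi> j))) {..<n}))"

definition amplification_norm ::
    "nat \<Rightarrow> (('h::complex_hilbert_space \<Rightarrow>\<^sub>L 'h) \<Rightarrow> ('h \<Rightarrow>\<^sub>L 'h)) \<Rightarrow> ennreal"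
  where "amplification_norm n T =
    (SUP X\<in>{X. (\<forall>i<n. \<forall>j<n. X i j \<in> bounded_ops) \<and> matrix_norm n X \<le> 1}.
       matrix_norm n (\<lambda>i j. T (X i j)))"

definition cb_norm :: "(('h::complex_hilbert_space \<Rightarrow>\<^sub>L 'h) \<Rightarrow> ('h \<Rightarrow>\<^sub>L 'h)) \<Rightarrow> ennreal"
  where "cb_norm T = (SUP n\<in>{1..}. amplification_norm n T)"

definition jordan_op ::
    "('h::complex_hilbert_space \<Rightarrow>\<^sub>L 'h) \<Rightarrow> ('h \<Rightarrow>\<^sub>L 'h) \<Rightarrow> ('h \<Rightarrow>\<^sub>L 'h) \<Rightarrow> ('h \<Rightarrow>\<^sub>L 'h)"
  where "jordan_op a b x = (a o\<^sub>L x o\<^sub>L b) + (b o\<^sub>L x o\<^sub>L a)"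

end

theory Submission imports Defs begin

text \<open>Commuting operators on a two-dimensional space share an antiunitary involution \<open>C\<close> with
  \<open>\<langle>a u, C v\<rangle> = \<langle>u, C (a v)\<rangle>\<close> and likewise for \<open>b\<close>: their traceless parts are parallel, and for one
  traceless operator \<open>C\<close> is found by solving two real linear equations in three unknowns. Choose a
  unit vector \<open>\<eta>\<close> maximising \<open>\<parallel>a \<eta>\<parallel> \<parallel>b \<eta>\<parallel>\<close> and replace \<open>(a, b)\<close> by \<open>(t a, b / t)\<close> so that
  \<open>\<parallel>a \<eta>\<parallel> = \<parallel>b \<eta>\<parallel> = m\<close>. Then \<open>\<parallel>a v\<parallel>\<^sup>2 + \<parallel>b v\<parallel>\<^sup>2 \<le> 2m\<^sup>2\<parallel>v\<parallel>\<^sup>2\<close>. This bounds the column \<open>(a, b)\<close>, and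
  by means of \<open>C\<close> also the row, so the completely bounded norm is at most \<open>2m\<^sup>2\<close>. Conversely the
  pairs \<open>(b \<eta>, a \<eta>)\<close> and \<open>(C (a \<eta>), C (b \<eta>))\<close> have the same Gram matrix, so a partial isometry
  \<open>x\<close> maps one to the other, and \<open>\<langle>(a x b + b x a) \<eta>, C \<eta>\<rangle> = \<parallel>a \<eta>\<parallel>\<^sup>2 + \<parallel>b \<eta>\<parallel>\<^sup>2 = 2m\<^sup>2\<close>.\<close>

section \<open>Complex inner products\<close>

lemma cinner_add_right: "cinner x (y + z) = cinner x y + cinner x (z::'h::complex_hilbert_space)"
  by (metis cinner_add_left cinner_commute complex_cnj_add)

lemma cinner_scaleC_right: "cinner x (c *\<^sub>C y) = cnj c * cinner x (y::'h::complex_hilbert_space)"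
  by (metis cinner_commute cinner_scaleC_left complex_cnj_mult)

lemma cinner_scaleR_left: "cinner (r *\<^sub>R x) y = of_real r * cinner x (y::'h::complex_hilbert_space)"
  by (metis cinner_scaleC_left scaleC_of_real)

lemma cinner_scaleR_right: "cinner x (r *\<^sub>R y) = of_real r * cinner x (y::'h::complex_hilbert_space)"
  by (metis cinner_scaleC_right complex_cnj_complex_of_real scaleC_of_real)

lemma cinner_minus_left: "cinner (- x) y = - cinner x (y::'h::complex_hilbert_space)"
  using cinner_scaleR_left[of "-1" x y] by simp

lemma cinner_minus_right: "cinner x (- y) = - cinner x (y::'h::complex_hilbert_space)"
  using cinner_scaleR_right[of x "-1" y] by simp

lemma cinner_diff_left: "cinner (x - y) z = cinner x z - cinner y (z::'h::complex_hilbert_space)"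
  using cinner_add_left[of x "- y" z] by (simp add: cinner_minus_left)

lemma cinner_diff_right: "cinner x (y - z) = cinner x y - cinner x (z::'h::complex_hilbert_space)"
  using cinner_add_right[of x y "- z"] by (simp add: cinner_minus_right)

lemma cinner_zero_left [simp]: "cinner 0 y = 0"
  using cinner_scaleR_left[of 0 0 y] by simp

lemma cinner_zero_right [simp]: "cinner x 0 = 0"
  using cinner_scaleR_right[of x 0 0] by simp

lemmas cinner_simps = cinner_add_left cinner_add_right cinner_diff_left cinner_diff_right
  cinner_scaleC_left cinner_scaleC_right cinner_scaleR_left cinner_scaleR_right

lemma Re_cinner_commute: "Re (cinner x y) = Re (cinner y (x::'h::complex_hilbert_space))"
  by (subst cinner_commute) simp

lemma norm_add_sq:
  "(norm (x + y))\<^sup>2 = (norm x)\<^sup>2 + (norm y)\<^sup>2 + 2 * Re (cinner x (y::'h::complex_hilbert_space))"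
proof -
  have "(norm (x + y))\<^sup>2 = Re (cinner (x + y) (x + y))"
    by (simp add: cinner_self)
  also have "\<dots> = (norm x)\<^sup>2 + (norm y)\<^sup>2 + 2 * Re (cinner x y)"
    unfolding cinner_add_left cinner_add_right
    using Re_cinner_commute[of y x] by (simp add: cinner_self)
  finally show ?thesis .
qed

lemma norm_scaleC: "norm (c *\<^sub>C x) = cmod c * norm (x::'h::complex_hilbert_space)"
proof -
  have "complex_of_real ((norm (c *\<^sub>C x))\<^sup>2) = cinner (c *\<^sub>C x) (c *\<^sub>C x)"
    by (simp add: cinner_self)
  also have "\<dots> = c * cnj c * cinner x x"
    by (simp add: cinner_simps)
  also have "\<dots> = complex_of_real ((cmod c * norm x)\<^sup>2)"
    unfolding complex_norm_square[symmetric] cinner_self by (simp add: power_mult_distrib)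
  finally have "(norm (c *\<^sub>C x))\<^sup>2 = (cmod c * norm x)\<^sup>2"
    using of_real_eq_iff by blast
  then show ?thesis by (simp add: power2_eq_iff_nonneg)
qed

text \<open>Expand the squared norm, which is nonnegative, of
  \<open>v - cinner v e *\<^sub>C e - cinner v f *\<^sub>C f\<close>. Allowing norms below 1 admits
  the vector \<open>sgn 0 = 0\<close>.\<close>

lemma Bessel_two:
  fixes e f v :: "'h::complex_hilbert_space"
  assumes "norm e \<le> 1" "norm f \<le> 1" "cinner e f = 0"
  shows "(cmod (cinner v e))\<^sup>2 + (cmod (cinner v f))\<^sup>2 \<le> (norm v)\<^sup>2"
proof -
  define \<alpha> \<beta> where "\<alpha> = cinner v e" and "\<beta> = cinner v f"
  have 1: "(norm (- \<alpha> *\<^sub>C e + - \<beta> *\<^sub>C f))\<^sup>2 = (cmod \<alpha> * norm e)\<^sup>2 + (cmod \<beta> * norm f)\<^sup>2"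
    unfolding norm_add_sq norm_scaleC cinner_simps assms(3) by (simp add: power_mult_distrib)
  have "Re (cinner v (- \<alpha> *\<^sub>C e + - \<beta> *\<^sub>C f)) = - Re (\<alpha> * cnj \<alpha>) - Re (\<beta> * cnj \<beta>)"
    by (simp only: cinner_simps complex_cnj_minus \<alpha>_def[symmetric] \<beta>_def[symmetric]) (simp add: mult.commute)
  then have 2: "Re (cinner v (- \<alpha> *\<^sub>C e + - \<beta> *\<^sub>C f)) = - (cmod \<alpha>)\<^sup>2 - (cmod \<beta>)\<^sup>2"
    unfolding cmod_power2 by (simp add: power2_eq_square)
  have "0 \<le> (norm (v + (- \<alpha> *\<^sub>C e + - \<beta> *\<^sub>C f)))\<^sup>2" by simp
  also have "\<dots> = (norm v)\<^sup>2 + ((cmod \<alpha> * norm e)\<^sup>2 + (cmod \<beta> * norm f)\<^sup>2)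
      - 2 * ((cmod \<alpha>)\<^sup>2 + (cmod \<beta>)\<^sup>2)"
    unfolding norm_add_sq[of v] 1 2 by simp
  finally have "2 * ((cmod \<alpha>)\<^sup>2 + (cmod \<beta>)\<^sup>2)
      \<le> (norm v)\<^sup>2 + ((cmod \<alpha> * norm e)\<^sup>2 + (cmod \<beta> * norm f)\<^sup>2)" by simp
  moreover have "(cmod \<alpha> * norm e)\<^sup>2 \<le> (cmod \<alpha>)\<^sup>2" "(cmod \<beta> * norm f)\<^sup>2 \<le> (cmod \<beta>)\<^sup>2"
    using assms by (auto intro!: power_mono mult_left_le)
  moreover have "A + B \<le> n" if "2 * (A + B) \<le> n + (A' + B')" "A' \<le> A" "B' \<le> B"
    for A B n A' B' :: real
    using that by simp
  ultimately show ?thesis unfolding \<alpha>_def \<beta>_def by blast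
qed

lemma cinner_sgn_right: "cinner x (sgn y) = cinner x y / norm (y::'h::complex_hilbert_space)"
  by (simp add: sgn_div_norm cinner_scaleR_right divide_inverse mult.commute)

text \<open>Cauchy--Schwarz, from \<open>Bessel_two\<close> with the pair \<open>sgn y\<close>,
  \<open>0\<close>.\<close>

lemma norm_cinner_le: "cmod (cinner x y) \<le> norm x * norm (y::'h::complex_hilbert_space)"
proof (cases "y = 0")
  case False
  have "(cmod (cinner x (sgn y)))\<^sup>2 \<le> (norm x)\<^sup>2"
    using Bessel_two[of "sgn y" 0 x] by (simp add: norm_sgn)
  then have "cmod (cinner x (sgn y)) \<le> norm x" by (simp add: power2_le_iff_abs_le)
  with False show ?thesis by (simp add: cinner_sgn_right norm_divide field_simps)
qed simp

text \<open>Gram--Schmidt on both pairs; since \<open>sgn 0 = 0\<close>, dependent or zero vectors need no separate case.\<close>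

lemma partial_isometry_of_gram:
  fixes p q p' q' :: "'h::complex_hilbert_space"
  assumes "norm p = norm p'" "norm q = norm q'" "cinner p q = cinner p' q'"
  obtains x where "x \<in> bounded_ops" "norm x \<le> 1"
    "blinfun_apply x p = p'" "blinfun_apply x q = q'"
proof -
  define w where "w = (\<lambda>p q :: 'h. q - cinner q (sgn p) *\<^sub>C sgn p)"
  have sgn_self: "cinner p (sgn p) = norm p" for p :: 'h
    by (cases "p = 0") (simp_all add: cinner_sgn_right cinner_self power2_eq_square)
  have orth: "cinner (sgn p) (w p q) = 0" for p q :: 'h
    by (cases "p = 0") (simp_all add: w_def cinner_simps cinner_self norm_sgn cinner_commute[of q])
  have orth': "cinner (sgn p) (sgn (w p q)) = 0" for p q :: 'h
    by (simp add: cinner_sgn_right orth)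
  have decomp: "q = w p q + cinner q (sgn p) *\<^sub>C sgn p" for p q :: 'h
    by (simp add: w_def)
  have norm_w: "(norm q)\<^sup>2 = (norm (w p q))\<^sup>2 + (cmod (cinner q (sgn p)))\<^sup>2" for p q :: 'h
  proof -
    have "cinner (w p q) (sgn p) = 0" using orth[of p q] by (subst cinner_commute) simp
    then show ?thesis
      by (cases "p = 0")
        (subst decomp[of q p], simp add: norm_add_sq norm_scaleC cinner_simps norm_sgn)+
  qed
  \<comment> \<open>Equal Gram data give equal Gram--Schmidt coefficients, hence orthogonal
    components of equal length.\<close>
  have coeff: "cinner q (sgn p) = cinner q' (sgn p')"
    using assms by (simp add: cinner_sgn_right cinner_commute[of q] cinner_commute[of q'])
  with norm_w[of q p] norm_w[of q' p'] assms(2) have norm_w_eq: "norm (w p q) = norm (w p' q')"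
    by (simp add: power2_eq_iff_nonneg)
  \<comment> \<open>\<open>X\<close> carries the Gram--Schmidt vectors of \<open>(p, q)\<close> to
    those of \<open>(p', q')\<close> and annihilates their orthogonal complement.\<close>
  define X where "X = (\<lambda>v. cinner v (sgn p) *\<^sub>C sgn p' + cinner v (sgn (w p q)) *\<^sub>C sgn (w p' q'))"
  have X_le: "norm (X v) \<le> norm v" for v
  proof -
    have "(norm (X v))\<^sup>2 = (cmod (cinner v (sgn p)) * norm (sgn p'))\<^sup>2
        + (cmod (cinner v (sgn (w p q))) * norm (sgn (w p' q')))\<^sup>2"
      by (simp add: X_def norm_add_sq norm_scaleC cinner_simps orth')
    also have "\<dots> \<le> (cmod (cinner v (sgn p)))\<^sup>2 + (cmod (cinner v (sgn (w p q))))\<^sup>2"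
      by (intro add_mono power_mono mult_left_le) (auto simp: norm_sgn)
    also have "\<dots> \<le> (norm v)\<^sup>2"
      by (intro Bessel_two) (auto simp: norm_sgn orth')
    finally show ?thesis by (simp add: power2_le_iff_abs_le)
  qed
  have X_scale: "X (c *\<^sub>C v) = c *\<^sub>C X v" for c v
    by (simp add: X_def cinner_simps scaleC_add_right scaleC_scaleC)
  have "bounded_linear X"
  proof (rule bounded_linear_intro)
    show "X (u + v) = X u + X v" for u v
      by (simp add: X_def cinner_simps scaleC_add_left algebra_simps)
    show "X (r *\<^sub>R v) = r *\<^sub>R X v" for r v
      using X_scale[of "of_real r" v] by (simp add: scaleC_of_real)
    show "norm (X v) \<le> norm v * 1" for v using X_le by simp
  qed
  then have apply_X: "blinfun_apply (Blinfun X) = X" by (rule bounded_linear_Blinfun_apply)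
  have unsgn: "complex_of_real (norm u) *\<^sub>C sgn u = u" for u :: 'h
    by (cases "u = 0") (simp_all add: scaleC_of_real sgn_div_norm)
  have "cinner p (sgn (w p q)) = 0"
    using orth'[of p q] by (subst unsgn[of p, symmetric]) (simp add: cinner_simps)
  then have Xp: "X p = p'"
    using assms(1) unsgn[of p'] by (simp add: X_def sgn_self)
  have "cinner q (sgn (w p q)) = norm (w p q)"
    by (subst decomp[of q p]) (simp add: cinner_simps sgn_self orth')
  then have Xq: "X q = q'"
    using unsgn[of "w p' q'"] decomp[of q' p'] coeff norm_w_eq by (simp add: X_def add.commute)
  show thesis
    by (rule that[of "Blinfun X"])
      (auto simp: apply_X bounded_ops_def X_scale Xp Xq X_le intro!: norm_blinfun_bound)
qed

section \<open>Two-dimensional spaces\<close>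

lemma orthonormal_basis_2:
  assumes "complex_vector.dim (UNIV :: 'h::complex_hilbert_space set) = 2"
  obtains e f :: "'h::complex_hilbert_space" where "cinner e e = 1" "cinner f f = 1" "cinner e f = 0" "cinner f e = 0"
    "\<And>v. v = cinner v e *\<^sub>C e + cinner v f *\<^sub>C f"
proof -
  obtain B :: "'h set" where B: "complex_vector.independent B" "complex_vector.span B = UNIV"
      "card B = 2"
    by (metis assms complex_vector.basis_exists complex_vector.span_UNIV complex_vector.span_eq
        top.extremum_uniqueI)
  then obtain u v where uv: "B = {u, v}" "u \<noteq> v" by (auto simp: card_2_iff)
  have u0: "u \<noteq> 0" using B(1) uv complex_vector.dependent_zero by blast
  define e where "e = sgn u"
  have ee: "cinner e e = 1" using u0 by (simp add: e_def cinner_self norm_sgn)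
  define w where "w = v - cinner v e *\<^sub>C e"
  have ew: "cinner e w = 0" by (simp add: w_def cinner_simps ee cinner_commute[of v])
  have e_scale: "e = complex_of_real (inverse (norm u)) *\<^sub>C u"
    by (simp only: e_def sgn_div_norm scaleC_of_real)
  have u_scale: "u = complex_of_real (norm u) *\<^sub>C e"
    using u0 by (simp add: e_def sgn_div_norm scaleC_of_real)
  have w0: "w \<noteq> 0"
  proof
    assume "w = 0"
    then have "v = (cinner v e * complex_of_real (inverse (norm u))) *\<^sub>C u"
      using e_scale scaleC_scaleC by (simp add: w_def)
    then have "v \<in> complex_vector.span {u}"
      by (metis complex_vector.span_base complex_vector.span_scale insertI1)
    moreover have "{u, v} - {v} = {u}" using uv(2) by auto
    ultimately show False
      using B(1) uv unfolding complex_vector.dependent_def by auto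
  qed
  define f where "f = sgn w"
  have ff: "cinner f f = 1" using w0 by (simp add: f_def cinner_self norm_sgn)
  have ef: "cinner e f = 0" by (simp add: f_def cinner_sgn_right ew)
  then have fe: "cinner f e = 0" by (subst cinner_commute) simp
  have v_eq: "v = cinner v e *\<^sub>C e + complex_of_real (norm w) *\<^sub>C f"
    using w0 by (simp add: f_def sgn_div_norm scaleC_of_real) (simp add: w_def)
  have "x = cinner x e *\<^sub>C e + cinner x f *\<^sub>C f" for x
  proof -
    have "u \<in> complex_vector.span {e, f}" "v \<in> complex_vector.span {e, f}"
      by (subst u_scale, simp add: complex_vector.span_base complex_vector.span_scale)
        (subst v_eq, simp add: complex_vector.span_base complex_vector.span_scale complex_vector.span_add)
    then have "complex_vector.span B \<subseteq> complex_vector.span {e, f}"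
      by (intro complex_vector.span_minimal) (auto simp: uv)
    then have "x \<in> complex_vector.span {e, f}" using B(2) by auto
    then obtain k where "x - k *\<^sub>C e \<in> complex_vector.span {f}"
      by (auto simp: complex_vector.span_insert)
    then obtain l where "x - k *\<^sub>C e = l *\<^sub>C f"
      by (auto simp: complex_vector.span_singleton)
    then have "x = k *\<^sub>C e + l *\<^sub>C f" by (simp add: algebra_simps)
    then show ?thesis by (simp add: cinner_simps ee ff ef fe)
  qed
  with ee ff ef fe show thesis by (rule that)
qed

text \<open>Two real equations in three real unknowns.\<close>

lemma conjugation_coefficients:
  fixes p q r :: complex
  obtains \<alpha> :: complex and \<beta> :: real
    where "(cmod \<alpha>)\<^sup>2 + \<beta>\<^sup>2 = 1" "p * \<beta> = q * \<alpha> + r * cnj \<alpha>"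
proof -
  define F :: "complex \<times> real \<Rightarrow> complex"
    where "F = (\<lambda>z. p * of_real (snd z) - q * fst z - r * cnj (fst z))"
  have lin: "linear F"
    by (rule linearI) (auto simp: F_def algebra_simps scaleR_conv_of_real)
  have "\<not> inj F"
  proof
    assume "inj F"
    then have "DIM(complex \<times> real) \<le> DIM(complex)"
      using lin by (metis dim_UNIV dim_image_eq dim_subset_UNIV span_UNIV inj_on_subset subset_UNIV)
    then show False by simp
  qed
  then obtain z where z: "F z = 0" "z \<noteq> 0"
    using lin linear_injective_0 by blast
  \<comment> \<open>The norm of \<open>complex \<times> real\<close> is Euclidean, so normalising a
    kernel vector yields the first equation.\<close>
  define y where "y = sgn z"
  have "F y = 0" using z lin by (simp add: y_def sgn_div_norm linear_scale)
  moreover have "(norm y)\<^sup>2 = 1" using z by (simp add: y_def norm_sgn)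
  ultimately show thesis
    by (intro that[of "fst y" "snd y"]) (simp_all add: F_def norm_prod_def algebra_simps)
qed

text \<open>The hypotheses say that the 2x2 minors of the two triples vanish. Hence a nonzero first
  triple has the second as a multiple, and its solution serves both; if the first triple is zero,
  solve for the second.\<close>

lemma conjugation_coefficients_parallel:
  fixes p q r p' q' r' :: complex
  assumes "p * q' = p' * q" "p * r' = p' * r" "q * r' = q' * r"
  obtains \<alpha> :: complex and \<beta> :: real
    where "(cmod \<alpha>)\<^sup>2 + \<beta>\<^sup>2 = 1" "p * \<beta> = q * \<alpha> + r * cnj \<alpha>" "p' * \<beta> = q' * \<alpha> + r' * cnj \<alpha>"
proof (cases "p = 0 \<and> q = 0 \<and> r = 0")
  case True
  with conjugation_coefficients[of p' q' r'] that show thesis by auto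
next
  case False
  then obtain c where c: "p' = c * p" "q' = c * q" "r' = c * r"
  proof -
    consider "p \<noteq> 0" | "q \<noteq> 0" | "r \<noteq> 0" using False by blast
    then show thesis
    proof cases
      case 1
      with that[of "p' / p"] assms show thesis by (simp add: field_simps)
    next
      case 2
      with that[of "q' / q"] assms show thesis by (simp add: field_simps)
    next
      case 3
      with that[of "r' / r"] assms show thesis by (simp add: field_simps)
    qed
  qed
  obtain \<alpha> :: complex and \<beta> :: real
    where *: "(cmod \<alpha>)\<^sup>2 + \<beta>\<^sup>2 = 1" "p * \<beta> = q * \<alpha> + r * cnj \<alpha>"
    using conjugation_coefficients by blast
  have "p' * \<beta> = c * (p * \<beta>)" by (simp add: c)
  also have "\<dots> = q' * \<alpha> + r' * cnj \<alpha>" by (simp add: *(2) c algebra_simps)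
  finally show thesis using * that by blast
qed

lemma bounded_ops_scaleC: "x \<in> bounded_ops \<Longrightarrow> blinfun_apply x (c *\<^sub>C v) = c *\<^sub>C blinfun_apply x v"
  by (simp add: bounded_ops_def)

text \<open>The matrix of \<open>C\<close> is the conjugate of the symmetric unitary matrix with rows
  \<open>(\<alpha>, \<beta>)\<close> and \<open>(\<beta>, - cnj \<alpha>)\<close>; an operator \<open>c\<close> is symmetric for the bilinear form
  \<open>cinner u (C v)\<close> iff \<open>\<beta> (c\<^sub>1\<^sub>1 - c\<^sub>2\<^sub>2) = \<alpha> c\<^sub>1\<^sub>2 + cnj \<alpha> c\<^sub>2\<^sub>1\<close>.\<close>

lemma commuting_conjugation:
  fixes a b :: "'h::complex_hilbert_space \<Rightarrow>\<^sub>L 'h"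
  assumes "complex_vector.dim (UNIV :: 'h set) = 2"
    and ab: "a \<in> bounded_ops" "b \<in> bounded_ops"
    and comm: "a o\<^sub>L b = b o\<^sub>L a"
  obtains C :: "'h \<Rightarrow> 'h" where
    "\<And>u v. cinner (C u) (C v) = cinner v u"
    "\<And>v. C (C v) = v"
    "\<And>u v. cinner (a u) (C v) = cinner u (C (a v))"
    "\<And>u v. cinner (b u) (C v) = cinner u (C (b v))"
proof -
  obtain e f :: 'h where on: "cinner e e = 1" "cinner f f = 1" "cinner e f = 0" "cinner f e = 0"
    and expand: "\<And>v. v = cinner v e *\<^sub>C e + cinner v f *\<^sub>C f"
    using orthonormal_basis_2[OF assms(1)] by metis
  have coord: "cinner (x v) g = cinner v e * cinner (x e) g + cinner v f * cinner (x f) g"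
    if "x \<in> bounded_ops" for x v g
    by (subst expand[of v])
      (simp only: blinfun.add_right bounded_ops_scaleC[OF that] cinner_add_left cinner_scaleC_left)
  have ext: "u = v" if "cinner u e = cinner v e" "cinner u f = cinner v f" for u v
    using expand[of u] expand[of v] that by simp
  have parseval: "cinner u v = cinner u e * cnj (cinner v e) + cinner u f * cnj (cinner v f)" for u v
    by (subst expand[of u], subst expand[of v]) (simp add: cinner_simps on)
  have ab_eq: "cinner (b v) e * cinner (a e) g + cinner (b v) f * cinner (a f) g
      = cinner (a v) e * cinner (b e) g + cinner (a v) f * cinner (b f) g" for v g
    unfolding coord[OF ab(1), of "b v", symmetric] coord[OF ab(2), of "a v", symmetric]
    using comm by (metis blinfun_apply_blinfun_compose)
  \<comment> \<open>Difference of the diagonal entries and the two off-diagonal entries: these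
    describe the traceless parts of \<open>a\<close> and \<open>b\<close>. Three matrix entries of
    \<open>ab = ba\<close> are the vanishing minors.\<close>
  define p q r p' q' r' where
    "p = cinner (a e) e - cinner (a f) f" "q = cinner (a f) e" "r = cinner (a e) f"
    "p' = cinner (b e) e - cinner (b f) f" "q' = cinner (b f) e" "r' = cinner (b e) f"
  note defs = this
  have "p * q' = p' * q" "p * r' = p' * r" "q * r' = q' * r"
    using ab_eq[of f e] ab_eq[of e f] ab_eq[of e e]
    by (simp_all add: defs on algebra_simps)
  then obtain \<alpha> :: complex and \<beta> :: real where unit: "(cmod \<alpha>)\<^sup>2 + \<beta>\<^sup>2 = 1"
    and a_coeff: "p * \<beta> = q * \<alpha> + r * cnj \<alpha>" and b_coeff: "p' * \<beta> = q' * \<alpha> + r' * cnj \<alpha>"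
    using conjugation_coefficients_parallel by blast
  have unit': "\<alpha> * cnj \<alpha> + complex_of_real \<beta> * complex_of_real \<beta> = 1"
    using unit unfolding complex_norm_square[symmetric]
    by (metis of_real_1 of_real_add of_real_mult power2_eq_square)
  define C where "C = (\<lambda>v. cnj (\<alpha> * cinner v e + \<beta> * cinner v f) *\<^sub>C e
    + cnj (\<beta> * cinner v e - cnj \<alpha> * cinner v f) *\<^sub>C f)"
  have C_e: "cinner (C v) e = cnj (\<alpha> * cinner v e + \<beta> * cinner v f)"
    and C_f: "cinner (C v) f = cnj (\<beta> * cinner v e - cnj \<alpha> * cinner v f)" for v
    by (simp_all add: C_def cinner_simps on)
  have "cinner (C u) (C v) = cinner v u" for u v
  proof -
    have "cinner (C u) (C v) = (\<alpha> * cnj \<alpha> + complex_of_real \<beta> * complex_of_real \<beta>)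
        * (cinner v e * cnj (cinner u e) + cinner v f * cnj (cinner u f))"
      unfolding parseval[of "C u" "C v"] C_e C_f by (simp add: algebra_simps)
    then show ?thesis unfolding unit' parseval[of v u] by simp
  qed
  moreover have "C (C v) = v" for v
  proof (rule ext)
    have "cinner (C (C v)) e = (\<alpha> * cnj \<alpha> + complex_of_real \<beta> * complex_of_real \<beta>) * cinner v e"
      unfolding C_e C_f by (simp add: algebra_simps)
    then show "cinner (C (C v)) e = cinner v e" using unit' by simp
    have "cinner (C (C v)) f = (\<alpha> * cnj \<alpha> + complex_of_real \<beta> * complex_of_real \<beta>) * cinner v f"
      unfolding C_e C_f by (simp add: algebra_simps)
    then show "cinner (C (C v)) f = cinner v f" using unit' by simp
  qed
  moreover have "cinner (x u) (C v) = cinner u (C (x v))"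
    if x: "x \<in> bounded_ops"
      and eq: "(cinner (x e) e - cinner (x f) f) * \<beta> = cinner (x f) e * \<alpha> + cinner (x e) f * cnj \<alpha>"
    for x u v
  proof -
    \<comment> \<open>The left side is an alternating bilinear form in \<open>u\<close> and
      \<open>v\<close>, hence in dimension two a multiple of the determinant; the multiple is zero
      by \<open>eq\<close>.\<close>
    have "cinner (x u) (C v) - cinner u (C (x v)) =
      ((cinner (x e) e - cinner (x f) f) * \<beta> - (cinner (x f) e * \<alpha> + cinner (x e) f * cnj \<alpha>))
        * (cinner u e * cinner v f - cinner u f * cinner v e)"
      unfolding parseval[of "x u" "C v"] parseval[of u "C (x v)"] C_e C_f coord[OF x, of u e] coord[OF x, of u f]
        coord[OF x, of v e] coord[OF x, of v f]
      by (simp add: algebra_simps)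
    then show ?thesis using eq by simp
  qed
  ultimately show thesis
    using that[of C] ab a_coeff b_coeff unfolding defs by blast
qed

section \<open>Maximising the product of the norms\<close>

lemma product_maximizer_2:
  fixes a b :: "'h::complex_hilbert_space \<Rightarrow>\<^sub>L 'h"
  assumes "complex_vector.dim (UNIV :: 'h set) = 2" "a \<noteq> 0" "b \<noteq> 0"
  obtains \<eta> where "norm \<eta> = 1" "a \<eta> \<noteq> 0" "b \<eta> \<noteq> 0"
    "\<And>v. norm (a v) * norm (b v) \<le> norm (a \<eta>) * norm (b \<eta>) * (norm v)\<^sup>2"
proof -
  obtain e f :: 'h where on: "cinner e e = 1" "cinner f f = 1" "cinner e f = 0" "cinner f e = 0"
    and expand: "\<And>v. v = cinner v e *\<^sub>C e + cinner v f *\<^sub>C f"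
    using orthonormal_basis_2[OF assms(1)] by metis
  \<comment> \<open>An isometry of the coordinate space onto H, through which compactness of the
    unit sphere supplies a maximiser.\<close>
  define E where "E = (\<lambda>z :: complex \<times> complex. fst z *\<^sub>C e + snd z *\<^sub>C f)"
  have norm_E: "norm (E z) = norm z" for z
  proof -
    have "norm e = 1" "norm f = 1"
      using on(1,2) unfolding cinner_self of_real_eq_1_iff by (simp_all add: abs_square_eq_1)
    then have "(norm (E z))\<^sup>2 = (norm z)\<^sup>2"
      by (simp add: E_def norm_add_sq norm_scaleC cinner_simps on norm_prod_def)
    then show ?thesis by (simp add: power2_eq_iff_nonneg)
  qed
  have "linear E"
    by (rule linearI)
      (simp_all add: E_def scaleC_add_left scaleC_add_right scaleC_scaleC scaleR_conv_of_real
        scaleC_of_real[symmetric, where 'a = 'h])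
  then have "bounded_linear E"
    by (simp add: linear_conv_bounded_linear)
  then have cont: "continuous_on (sphere 0 1) (\<lambda>z. norm (a (E z)) * norm (b (E z)))"
    by (intro continuous_intros linear_continuous_on bounded_linear_compose[OF blinfun.bounded_linear_right])
  obtain z where z: "norm z = 1"
    and max: "\<And>y. norm y = 1 \<Longrightarrow> norm (a (E y)) * norm (b (E y)) \<le> norm (a (E z)) * norm (b (E z))"
    using continuous_attains_sup[OF _ _ cont] by (auto simp del: split_paired_All split_paired_Ex)
  have le: "norm (a v) * norm (b v) \<le> norm (a (E z)) * norm (b (E z)) * (norm v)\<^sup>2" for v
  proof (cases "v = 0")
    case False
    define y where "y = (cinner (sgn v) e, cinner (sgn v) f)"
    have "E y = sgn v" using expand[of "sgn v"] by (simp add: E_def y_def)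
    moreover from this have "norm y = 1" using norm_E[of y] False by (simp add: norm_sgn)
    ultimately have "norm (a (sgn v)) * norm (b (sgn v)) \<le> norm (a (E z)) * norm (b (E z))"
      using max by metis
    then show ?thesis using False
      by (simp add: sgn_div_norm blinfun.scaleR_right field_simps power2_eq_square)
  qed (simp add: blinfun.zero_right)
  obtain u v where u: "a u \<noteq> 0" and v: "b v \<noteq> 0"
    using assms(2,3) by (metis blinfun_eqI zero_blinfun.rep_eq)
  \<comment> \<open>The two kernels are proper subspaces and cannot cover the space; so the maximum
    is positive.\<close>
  have "\<exists>w. a w \<noteq> 0 \<and> b w \<noteq> 0"
  proof (cases "b u = 0 \<and> a v = 0")
    case True
    with u v show ?thesis by (intro exI[of _ "u + v"]) (simp add: blinfun.add_right)
  qed (use u v in auto)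
  then obtain w where w: "a w \<noteq> 0" "b w \<noteq> 0" by blast
  then have "0 < norm (a w) * norm (b w)" by simp
  with le[of w] have "a (E z) \<noteq> 0" "b (E z) \<noteq> 0" by auto
  with le z norm_E show thesis by (intro that[of "E z"]) auto
qed

text \<open>At \<open>\<eta> + t\<omega>v\<close> the product of the norms is governed by the excess \<open>h\<close> of
  \<open>\<parallel>a \<cdot>\<parallel>\<^sup>2 + \<parallel>b \<cdot>\<parallel>\<^sup>2\<close> over \<open>2m\<^sup>2\<parallel>\<cdot>\<parallel>\<^sup>2\<close> and the difference \<open>D\<close> of the two squares: maximality of
  \<open>\<eta>\<close> yields \<open>4m\<^sup>2 h \<parallel>\<cdot>\<parallel>\<^sup>2 + h\<^sup>2 \<le> D\<^sup>2\<close>. A suitable phase \<open>\<omega>\<close> removes the first-order term of \<open>D\<close>, so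
  \<open>D\<^sup>2 = O(t\<^sup>4)\<close>, while \<open>h\<close> would be at least of order \<open>t\<^sup>2\<close> if it were positive at \<open>v\<close>.\<close>

lemma sum_squares_le_of_product_le:
  fixes a b :: "'h::complex_hilbert_space \<Rightarrow>\<^sub>L 'h"
  assumes ab: "a \<in> bounded_ops" "b \<in> bounded_ops"
    and \<eta>: "norm \<eta> = 1" "norm (a \<eta>) = m" "norm (b \<eta>) = m" "m > 0"
    and max: "\<And>v. norm (a v) * norm (b v) \<le> m\<^sup>2 * (norm v)\<^sup>2"
  shows "(norm (a v))\<^sup>2 + (norm (b v))\<^sup>2 \<le> 2 * m\<^sup>2 * (norm v)\<^sup>2"
proof (rule ccontr)
  define h where "h = (\<lambda>v. (norm (a v))\<^sup>2 + (norm (b v))\<^sup>2 - 2 * m\<^sup>2 * (norm v)\<^sup>2)"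
  define D where "D = (\<lambda>v. (norm (a v))\<^sup>2 - (norm (b v))\<^sup>2)"
  assume "\<not> ?thesis"
  then have hv: "h v > 0" by (simp add: h_def)
  \<comment> \<open>Apply \<open>4xy = (x + y)^2 - (x - y)^2\<close> to the squared norms
    \<open>x\<close>, \<open>y\<close> of \<open>a v\<close> and \<open>b v\<close>, with
    \<open>x + y = h v + 2 m^2 \<parallel>v\<parallel>^2\<close> and
    \<open>x - y = D v\<close>.\<close>
  have hD: "4 * m\<^sup>2 * h v * (norm v)\<^sup>2 + (h v)\<^sup>2 \<le> (D v)\<^sup>2" for v
  proof -
    have "(norm (a v) * norm (b v))\<^sup>2 \<le> (m\<^sup>2 * (norm v)\<^sup>2)\<^sup>2"
      by (intro power_mono max) simp
    then show ?thesis by (simp add: h_def D_def power2_eq_square algebra_simps)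
  qed
  \<comment> \<open>\<open>h\<close> and \<open>D\<close> vanish at \<open>\<eta>\<close>; their
    first-order coefficients there in direction \<open>v\<close> are \<open>2 Re k\<close> and
    \<open>2 Re d\<close>. Rotating \<open>v\<close> by \<open>\<omega>\<close> multiplies
    \<open>k\<close> and \<open>d\<close> by \<open>cnj \<omega>\<close>.\<close>
  define k where "k = cinner (a \<eta>) (a v) + cinner (b \<eta>) (b v) - 2 * of_real (m\<^sup>2) * cinner \<eta> v"
  define d where "d = cinner (a \<eta>) (a v) - cinner (b \<eta>) (b v)"
  obtain \<omega> where \<omega>: "cmod \<omega> = 1" "Re (cnj \<omega> * d) = 0" "Re (cnj \<omega> * k) \<ge> 0"
  proof -
    \<comment> \<open>This phase makes \<open>cnj \<omega> * d\<close> purely imaginary. That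
      survives a change of sign, which is then used to make \<open>Re (cnj \<omega> * k)\<close>
      nonnegative.\<close>
    define \<omega> where "\<omega> = (if d = 0 then 1 else \<i> * sgn d)"
    have 1: "cmod \<omega> = 1" by (simp add: \<omega>_def norm_mult norm_sgn)
    have 2: "Re (cnj \<omega> * d) = 0"
      by (simp add: \<omega>_def sgn_div_norm mult.commute)
    show thesis
      using that[of \<omega>] that[of "- \<omega>"] 1 2 by (cases "Re (cnj \<omega> * k) \<ge> 0") auto
  qed
  define u where "u = \<omega> *\<^sub>C v"
  have norm_u: "norm u = norm v" "norm (a u) = norm (a v)" "norm (b u) = norm (b v)"
    using \<omega>(1) ab by (simp_all add: u_def norm_scaleC bounded_ops_scaleC)
  have norm_sq: "(norm (x + t *\<^sub>R y))\<^sup>2 = (norm x)\<^sup>2 + t\<^sup>2 * (norm y)\<^sup>2 + 2 * t * Re (cinner x y)"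
    for x y :: 'h and t
    by (simp add: norm_add_sq cinner_simps power_mult_distrib)
  have Re_k: "Re (cinner (a \<eta>) (a u)) + Re (cinner (b \<eta>) (b u)) - 2 * m\<^sup>2 * Re (cinner \<eta> u)
      = Re (cnj \<omega> * k)"
    using ab by (simp add: u_def bounded_ops_scaleC cinner_simps k_def algebra_simps)
  have Re_d: "Re (cinner (a \<eta>) (a u)) - Re (cinner (b \<eta>) (b u)) = 0"
    using \<omega>(2) ab by (simp add: u_def bounded_ops_scaleC cinner_simps d_def algebra_simps)
  have h_path: "h (\<eta> + t *\<^sub>R u) = t\<^sup>2 * h v + 2 * t * Re (cnj \<omega> * k)" for t
    unfolding Re_k[symmetric] by (simp add: h_def blinfun.bilinear_simps norm_sq norm_u \<eta> algebra_simps)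
  have D_path: "D (\<eta> + t *\<^sub>R u) = t\<^sup>2 * D v" for t
    using Re_d by (simp add: D_def blinfun.bilinear_simps norm_sq norm_u \<eta> algebra_simps)
  have ineq: "4 * m\<^sup>2 * h v * (norm (\<eta> + t *\<^sub>R u))\<^sup>2 \<le> t\<^sup>2 * (D v)\<^sup>2" if "t > 0" for t
  proof -
    have "t\<^sup>2 * h v \<le> h (\<eta> + t *\<^sub>R u)" using \<omega>(3) that by (simp add: h_path)
    then have "4 * m\<^sup>2 * (t\<^sup>2 * h v) * (norm (\<eta> + t *\<^sub>R u))\<^sup>2
        \<le> 4 * m\<^sup>2 * h (\<eta> + t *\<^sub>R u) * (norm (\<eta> + t *\<^sub>R u))\<^sup>2"
      by (intro mult_right_mono mult_left_mono) auto
    also have "\<dots> \<le> (t\<^sup>2 * D v)\<^sup>2"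
      using hD[of "\<eta> + t *\<^sub>R u"] zero_le_power2[of "h (\<eta> + t *\<^sub>R u)"] unfolding D_path by linarith
    finally have "t\<^sup>2 * (4 * m\<^sup>2 * h v * (norm (\<eta> + t *\<^sub>R u))\<^sup>2) \<le> t\<^sup>2 * (t\<^sup>2 * (D v)\<^sup>2)"
      by (simp add: power_mult_distrib power2_eq_square mult_ac)
    then show ?thesis using that by (simp only: mult_le_cancel_left_pos zero_less_power)
  qed
  \<comment> \<open>As \<open>t\<close> tends to 0 the left side of \<open>ineq\<close> tends to
    \<open>4 m^2 h v > 0\<close>, since \<open>\<parallel>\<eta>\<parallel> = 1\<close>, and the
    right side to 0.\<close>
  have *: "((\<lambda>t. 4 * m\<^sup>2 * h v * (norm (\<eta> + t *\<^sub>R u))\<^sup>2) \<longlongrightarrow> 4 * m\<^sup>2 * h v * (norm (\<eta> + 0 *\<^sub>R u))\<^sup>2)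
      (at_right 0)"
    by (intro tendsto_intros)
  have **: "((\<lambda>t. t\<^sup>2 * (D v)\<^sup>2) \<longlongrightarrow> 0\<^sup>2 * (D v)\<^sup>2) (at_right 0)"
    by (intro tendsto_intros)
  have "4 * m\<^sup>2 * h v * (norm (\<eta> + 0 *\<^sub>R u))\<^sup>2 \<le> 0\<^sup>2 * (D v)\<^sup>2"
    by (rule tendsto_le[OF _ ** *]) (auto simp: eventually_at_filter ineq)
  with hv \<eta> show False by (simp add: mult_le_0_iff)
qed

section \<open>Norm bounds\<close>

text \<open>Homogeneity extends the bound from the unit ball to every vector; a vector of length 0
  cannot be rescaled and is treated apart.\<close>

lemma L2_set_le_of_matrix_norm_le:
  assumes "matrix_norm n X \<le> 1"
  shows "L2_set (\<lambda>i. norm (\<Sum>j<n. blinfun_apply (X i j) (\<xi> j))) {..<n}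
    \<le> L2_set (\<lambda>j. norm (\<xi> j)) {..<n}"
proof -
  have le1: "L2_set (\<lambda>i. norm (\<Sum>j<n. blinfun_apply (X i j) (\<zeta> j))) {..<n} \<le> 1"
    if "L2_set (\<lambda>j. norm (\<zeta> j)) {..<n} \<le> 1" for \<zeta>
  proof -
    have "ennreal (L2_set (\<lambda>i. norm (\<Sum>j<n. blinfun_apply (X i j) (\<zeta> j))) {..<n}) \<le> matrix_norm n X"
      unfolding matrix_norm_def by (rule SUP_upper) (use that in simp)
    also note assms
    finally show ?thesis by simp
  qed
  define L where "L = L2_set (\<lambda>j. norm (\<xi> j)) {..<n}"
  show ?thesis
  proof (cases "L = 0")
    case True
    then have "\<xi> j = 0" if "j < n" for j
      using that by (simp add: L_def L2_set_eq_0_iff)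
    then have "(\<Sum>j<n. blinfun_apply (X i j) (\<xi> j)) = 0" for i
      by (intro sum.neutral) (simp add: blinfun.zero_right)
    then show ?thesis by (simp add: L2_set_def sum_nonneg)
  next
    case False
    then have L: "L > 0" using L2_set_nonneg[of "\<lambda>j. norm (\<xi> j)" "{..<n}"] unfolding L_def by linarith
    have "L2_set (\<lambda>j. norm (inverse L *\<^sub>R \<xi> j)) {..<n} = inverse L * L"
      using L unfolding L_def by (simp add: L2_set_right_distrib)
    then have "L2_set (\<lambda>i. norm (\<Sum>j<n. blinfun_apply (X i j) (inverse L *\<^sub>R \<xi> j))) {..<n} \<le> 1"
      using L by (intro le1) simp
    moreover have eq: "L2_set (\<lambda>i. norm (\<Sum>j<n. blinfun_apply (X i j) (inverse L *\<^sub>R \<xi> j))) {..<n}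
        = inverse L * L2_set (\<lambda>i. norm (\<Sum>j<n. blinfun_apply (X i j) (\<xi> j))) {..<n}"
      using L by (simp add: blinfun.scaleR_right scaleR_sum_right[symmetric] L2_set_right_distrib)
    ultimately have "inverse L * L2_set (\<lambda>i. norm (\<Sum>j<n. blinfun_apply (X i j) (\<xi> j))) {..<n} \<le> 1"
      unfolding eq by -
    then show ?thesis using L by (simp add: L_def[symmetric] field_simps)
  qed
qed

text \<open>The amplified map sends \<open>X\<close> to the row \<open>(a, b)\<close> times
  \<open>X \<oplus> X\<close> times the column \<open>(b, a)\<close>, with \<open>a\<close> and
  \<open>b\<close> acting on each coordinate. Row and column have norm at most
  \<open>sqrt N\<close>, and \<open>X \<oplus> X\<close> is a contraction.\<close>

lemma cb_norm_jordan_op_le: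
  fixes a b :: "'h::complex_hilbert_space \<Rightarrow>\<^sub>L 'h"
  assumes "N \<ge> 0"
    and row: "\<And>u v. (norm (a u + b v))\<^sup>2 \<le> N * ((norm u)\<^sup>2 + (norm v)\<^sup>2)"
    and col: "\<And>v. (norm (a v))\<^sup>2 + (norm (b v))\<^sup>2 \<le> N * (norm v)\<^sup>2"
  shows "cb_norm (jordan_op a b) \<le> ennreal N"
  unfolding cb_norm_def amplification_norm_def matrix_norm_def[of _ "\<lambda>i j. jordan_op a b (_ i j)"]
proof (intro SUP_least, safe)
  fix n :: nat and X :: "nat \<Rightarrow> nat \<Rightarrow> 'h \<Rightarrow>\<^sub>L 'h" and \<xi> :: "nat \<Rightarrow> 'h"
  assume X: "matrix_norm n X \<le> 1" and \<xi>: "L2_set (\<lambda>j. norm (\<xi> j)) {..<n} \<le> 1"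
  have contr: "(\<Sum>i<n. (norm (\<Sum>j<n. blinfun_apply (X i j) (\<zeta> j)))\<^sup>2) \<le> (\<Sum>j<n. (norm (\<zeta> j))\<^sup>2)" for \<zeta>
    using L2_set_le_of_matrix_norm_le[OF X, of \<zeta>] by (simp add: L2_set_def)
  have \<xi>1: "(\<Sum>j<n. (norm (\<xi> j))\<^sup>2) \<le> 1" using \<xi> by (simp add: L2_set_def)
  define U V where "U = (\<lambda>i. \<Sum>j<n. blinfun_apply (X i j) (blinfun_apply b (\<xi> j)))"
    and "V = (\<lambda>i. \<Sum>j<n. blinfun_apply (X i j) (blinfun_apply a (\<xi> j)))"
  have eq: "(\<Sum>j<n. blinfun_apply (jordan_op a b (X i j)) (\<xi> j)) = a (U i) + b (V i)" for i
    by (simp add: jordan_op_def U_def V_def blinfun.bilinear_simps blinfun.sum_right sum.distrib)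
  have "(\<Sum>i<n. (norm (a (U i) + b (V i)))\<^sup>2) \<le> (\<Sum>i<n. N * ((norm (U i))\<^sup>2 + (norm (V i))\<^sup>2))"
    by (intro sum_mono row)
  also have "\<dots> = N * ((\<Sum>i<n. (norm (U i))\<^sup>2) + (\<Sum>i<n. (norm (V i))\<^sup>2))"
    by (simp add: sum_distrib_left[symmetric] sum.distrib)
  also have "\<dots> \<le> N * ((\<Sum>j<n. (norm (b (\<xi> j)))\<^sup>2) + (\<Sum>j<n. (norm (a (\<xi> j)))\<^sup>2))"
    unfolding U_def V_def using assms(1) by (intro mult_left_mono add_mono contr)
  also have "\<dots> = N * (\<Sum>j<n. (norm (a (\<xi> j)))\<^sup>2 + (norm (b (\<xi> j)))\<^sup>2)"
    by (simp add: sum.distrib)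
  also have "\<dots> \<le> N * (\<Sum>j<n. N * (norm (\<xi> j))\<^sup>2)"
    using assms(1) by (intro mult_left_mono sum_mono col)
  also have "\<dots> = N\<^sup>2 * (\<Sum>j<n. (norm (\<xi> j))\<^sup>2)"
    by (simp add: sum_distrib_left power2_eq_square mult.assoc)
  also have "\<dots> \<le> N\<^sup>2 * 1" using \<xi>1 by (intro mult_left_mono) auto
  finally have "L2_set (\<lambda>i. norm (\<Sum>j<n. blinfun_apply (jordan_op a b (X i j)) (\<xi> j))) {..<n} \<le> sqrt (N\<^sup>2)"
    unfolding L2_set_def eq by (intro real_sqrt_le_mono) simp
  with assms(1) show "ennreal (L2_set (\<lambda>i. norm (\<Sum>j<n. blinfun_apply (jordan_op a b (X i j)) (\<xi> j))) {..<n})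
      \<le> ennreal N"
    by (intro ennreal_leI) simp
qed

lemma matrix_norm_1: "matrix_norm 1 X = ennreal (norm (X 0 0))"
proof (rule antisym)
  show "matrix_norm 1 X \<le> ennreal (norm (X 0 0))"
    unfolding matrix_norm_def
    by (rule SUP_least)
      (auto simp: L2_set_def intro!: ennreal_leI order_trans[OF norm_blinfun] mult_left_le)
  show "ennreal (norm (X 0 0)) \<le> matrix_norm 1 X"
  \<comment> \<open>A finite supremum \<open>r\<close> bounds the operator norm; an infinite one
    leaves nothing to prove.\<close>
  proof (cases "matrix_norm 1 X")
    case (real r)
    have le: "norm (blinfun_apply (X 0 0) v) \<le> r" if "norm v \<le> 1" for v
    proof -
      have "ennreal (norm (blinfun_apply (X 0 0) v)) \<le> matrix_norm 1 X"
        unfolding matrix_norm_def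
        by (rule SUP_upper2[of "\<lambda>_. v"]) (auto simp: L2_set_def that)
      with real show ?thesis by simp
    qed
    have "norm (X 0 0) \<le> r"
    proof (rule norm_blinfun_bound)
      show "norm (blinfun_apply (X 0 0) v) \<le> r * norm v" for v
        using le[of "sgn v"]
        by (cases "v = 0") (simp_all add: norm_sgn sgn_div_norm blinfun.bilinear_simps field_simps)
    qed (use real in simp)
    with real show ?thesis by (simp add: ennreal_leI)
  qed simp
qed

text \<open>The amplification to 1x1 matrices is \<open>T\<close> itself.\<close>

lemma op_norm_le_cb_norm: "op_norm T \<le> cb_norm T"
proof -
  have "op_norm T \<le> amplification_norm 1 T"
    unfolding op_norm_def
  proof (rule SUP_least, safe)
    fix x :: "'a \<Rightarrow>\<^sub>L 'a"
    assume "x \<in> bounded_ops" "norm x \<le> 1"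
    then show "ennreal (norm (T x)) \<le> amplification_norm 1 T"
      unfolding amplification_norm_def matrix_norm_1
      by (intro SUP_upper2[of "\<lambda>_ _. x"]) auto
  qed
  also have "\<dots> \<le> cb_norm T" unfolding cb_norm_def by (rule SUP_upper) simp
  finally show ?thesis .
qed

section \<open>Jordan operators\<close>

text \<open>By \<open>sym\<close> the adjoints of \<open>a\<close> and \<open>b\<close> are
  \<open>C a C\<close> and \<open>C b C\<close>, so the adjoint of the row \<open>(a, b)\<close> is
  the column \<open>(a, b)\<close> up to the isometry \<open>C\<close>. Adjoints are avoided by
  pairing \<open>a u + b v\<close> with itself, written as \<open>C w\<close>.\<close>

lemma row_bound_of_column_bound:
  fixes a b :: "'h::complex_hilbert_space \<Rightarrow>\<^sub>L 'h" and C :: "'h \<Rightarrow> 'h"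
  assumes C: "\<And>u v. cinner (C u) (C v) = cinner v u" "\<And>v. C (C v) = v"
    and sym: "\<And>u v. cinner (a u) (C v) = cinner u (C (a v))"
      "\<And>u v. cinner (b u) (C v) = cinner u (C (b v))"
    and col: "\<And>v. (norm (a v))\<^sup>2 + (norm (b v))\<^sup>2 \<le> N * (norm v)\<^sup>2"
    and "N \<ge> 0"
  shows "(norm (a u + b v))\<^sup>2 \<le> N * ((norm u)\<^sup>2 + (norm v)\<^sup>2)"
proof -
  have norm_C: "norm (C v) = norm v" for v
    using C(1)[of v v] unfolding cinner_self of_real_eq_iff by (simp add: power2_eq_iff_nonneg)
  define w where "w = C (a u + b v)"
  define z where "z = norm (a u + b v)"
  have norm_w: "norm w = z" by (simp add: w_def z_def norm_C)
  have "complex_of_real (z\<^sup>2) = cinner (a u + b v) (C w)"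
    by (simp add: w_def C(2) cinner_self z_def)
  also have "\<dots> = cinner u (C (a w)) + cinner v (C (b w))"
    by (simp only: cinner_add_left sym)
  finally have "z\<^sup>2 = cmod (cinner u (C (a w)) + cinner v (C (b w)))"
    by (metis norm_of_real abs_power2)
  also have "\<dots> \<le> norm u * norm (a w) + norm v * norm (b w)"
    using norm_cinner_le[of u "C (a w)"] norm_cinner_le[of v "C (b w)"]
    by (intro norm_triangle_le) (simp add: norm_C)
  finally have "(z\<^sup>2)\<^sup>2 \<le> (norm u * norm (a w) + norm v * norm (b w))\<^sup>2"
    by (rule power_mono) simp
  also have "\<dots> \<le> ((norm u)\<^sup>2 + (norm v)\<^sup>2) * ((norm (a w))\<^sup>2 + (norm (b w))\<^sup>2)"
    using zero_le_power2[of "norm u * norm (b w) - norm v * norm (a w)"]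
    by (simp add: power2_eq_square algebra_simps)
  also have "\<dots> \<le> ((norm u)\<^sup>2 + (norm v)\<^sup>2) * (N * z\<^sup>2)"
    using col[of w] unfolding norm_w by (intro mult_left_mono) auto
  finally have "z\<^sup>2 * z\<^sup>2 \<le> z\<^sup>2 * (N * ((norm u)\<^sup>2 + (norm v)\<^sup>2))"
    by (simp add: power2_eq_square mult_ac)
  then show ?thesis
    unfolding z_def[symmetric] using \<open>N \<ge> 0\<close>
    by (cases "z = 0") (simp, simp only: mult_le_cancel_left_pos zero_less_power2 not_False_eq_True)
qed

lemma op_norm_jordan_op_ge:
  fixes a b :: "'h::complex_hilbert_space \<Rightarrow>\<^sub>L 'h" and C :: "'h \<Rightarrow> 'h"
  assumes C: "\<And>u v. cinner (C u) (C v) = cinner v u"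
    and sym: "\<And>u v. cinner (a u) (C v) = cinner u (C (a v))"
      "\<And>u v. cinner (b u) (C v) = cinner u (C (b v))"
    and \<eta>: "norm \<eta> = 1" "norm (a \<eta>) = m" "norm (b \<eta>) = m"
  shows "ennreal (2 * m\<^sup>2) \<le> op_norm (jordan_op a b)"
proof -
  have norm_C: "norm (C v) = norm v" for v
    using C[of v v] unfolding cinner_self of_real_eq_iff by (simp add: power2_eq_iff_nonneg)
  \<comment> \<open>\<open>C\<close> reverses inner products, so the images are taken in swapped
    order to match the mixed Gram entry; the norms match because \<open>\<parallel>a
    \<eta>\<parallel> = \<parallel>b \<eta>\<parallel>\<close>.\<close>
  obtain x where x: "x \<in> bounded_ops" "norm x \<le> 1" "x (b \<eta>) = C (a \<eta>)" "x (a \<eta>) = C (b \<eta>)"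
  proof (rule partial_isometry_of_gram)
    show "norm (b \<eta>) = norm (C (a \<eta>))" "norm (a \<eta>) = norm (C (b \<eta>))"
      by (simp_all only: norm_C \<eta>)
    show "cinner (b \<eta>) (a \<eta>) = cinner (C (a \<eta>)) (C (b \<eta>))"
      by (simp only: C)
  qed
  define y where "y = jordan_op a b x"
  have "cinner (y \<eta>) (C \<eta>) = cinner (a (C (a \<eta>))) (C \<eta>) + cinner (b (C (b \<eta>))) (C \<eta>)"
    by (simp add: y_def jordan_op_def blinfun.bilinear_simps x cinner_simps)
  also have "\<dots> = complex_of_real (2 * m\<^sup>2)"
    by (simp add: sym cinner_self norm_C \<eta>)
  finally have "2 * m\<^sup>2 = cmod (cinner (y \<eta>) (C \<eta>))"
    by (simp only: norm_of_real) simp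
  also have "\<dots> \<le> norm (y \<eta>)"
    using norm_cinner_le[of "y \<eta>" "C \<eta>"] by (simp add: norm_C \<eta>)
  also have "\<dots> \<le> norm y" using norm_blinfun[of y \<eta>] by (simp add: \<eta>)
  finally have "ennreal (2 * m\<^sup>2) \<le> ennreal (norm y)" by (rule ennreal_leI)
  also have "\<dots> \<le> op_norm (jordan_op a b)"
    unfolding op_norm_def y_def by (rule SUP_upper) (use x in simp)
  finally show ?thesis .
qed

text \<open>Both norms equal \<open>2 m^2\<close>: the column bound, used directly and through
  \<open>C\<close> for the row, gives the upper estimate, and the partial isometry at
  \<open>\<eta>\<close> attains it.\<close>

lemma cb_norm_jordan_op_balanced:
  fixes a b :: "'h::complex_hilbert_space \<Rightarrow>\<^sub>L 'h"
  assumes "complex_vector.dim (UNIV :: 'h set) = 2"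
    and ops: "a \<in> bounded_ops" "b \<in> bounded_ops" and comm: "a o\<^sub>L b = b o\<^sub>L a"
    and \<eta>: "norm \<eta> = 1" "norm (a \<eta>) = m" "norm (b \<eta>) = m" "m > 0"
    and max: "\<And>v. norm (a v) * norm (b v) \<le> m\<^sup>2 * (norm v)\<^sup>2"
  shows "cb_norm (jordan_op a b) = op_norm (jordan_op a b)"
proof -
  obtain C :: "'h \<Rightarrow> 'h" where C: "\<And>u v. cinner (C u) (C v) = cinner v u" "\<And>v. C (C v) = v"
    and sym: "\<And>u v. cinner (a u) (C v) = cinner u (C (a v))"
      "\<And>u v. cinner (b u) (C v) = cinner u (C (b v))"
    using commuting_conjugation[OF assms(1) ops comm] by metis
  note col = sum_squares_le_of_product_le[OF ops \<eta> max]
  have "cb_norm (jordan_op a b) \<le> ennreal (2 * m\<^sup>2)"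
    by (rule cb_norm_jordan_op_le[OF _ row_bound_of_column_bound[OF C sym col] col]) simp_all
  also have "\<dots> \<le> op_norm (jordan_op a b)"
    by (rule op_norm_jordan_op_ge[OF C(1) sym \<eta>(1-3)])
  finally show ?thesis using op_norm_le_cb_norm by (rule antisym)
qed

lemma cb_norm_zero: "cb_norm (\<lambda>_ :: 'h::complex_hilbert_space \<Rightarrow>\<^sub>L 'h. 0) = 0"
proof -
  have "cb_norm (\<lambda>_ :: 'h \<Rightarrow>\<^sub>L 'h. 0) \<le> 0"
    unfolding cb_norm_def amplification_norm_def matrix_norm_def[of _ "\<lambda>i j. 0"]
    by (intro SUP_least) (simp add: L2_set_def)
  then show ?thesis by simp
qed

lemma jordan_op_scaleR: "t \<noteq> 0 \<Longrightarrow> jordan_op (t *\<^sub>R a) (inverse t *\<^sub>R b) = jordan_op a b"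
  by (auto simp: jordan_op_def fun_eq_iff blinfun.bilinear_simps intro!: blinfun_eqI)

lemma bounded_ops_scaleR: "a \<in> bounded_ops \<Longrightarrow> t *\<^sub>R a \<in> bounded_ops"
  by (simp add: bounded_ops_def blinfun.bilinear_simps scaleC_of_real[symmetric] scaleC_scaleC
      mult.commute)

theorem proposition8:
  fixes a b :: "'h::complex_hilbert_space \<Rightarrow>\<^sub>L 'h"
  assumes "complex_vector.dim (UNIV :: 'h set) = 2"
    and "a \<in> bounded_ops" and "b \<in> bounded_ops"
    and "a o\<^sub>L b = b o\<^sub>L a"
  shows "cb_norm (jordan_op a b) = op_norm (jordan_op a b)"
proof (cases "a = 0 \<or> b = 0")
  \<comment> \<open>No vector gives a positive product of norms here, so balancing is impossible,
    but the operator is zero.\<close>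
  case True
  then have "jordan_op a b = (\<lambda>_. 0)"
    by (auto simp: jordan_op_def fun_eq_iff intro!: blinfun_eqI)
  with op_norm_le_cb_norm[of "jordan_op a b"] show ?thesis by (simp add: cb_norm_zero)
next
  case False
  then obtain \<eta> where \<eta>: "norm \<eta> = 1" "a \<eta> \<noteq> 0" "b \<eta> \<noteq> 0"
    "\<And>v. norm (a v) * norm (b v) \<le> norm (a \<eta>) * norm (b \<eta>) * (norm v)\<^sup>2"
    using product_maximizer_2[OF assms(1)] by metis
  \<comment> \<open>The solution of \<open>t \<parallel>a \<eta>\<parallel> = \<parallel>b
    \<eta>\<parallel> / t\<close>. Rescaling leaves the product of the norms unchanged, so
    \<open>\<eta>\<close> remains a maximiser, with maximum \<open>m^2\<close>.\<close>
  define t where "t = sqrt (norm (b \<eta>) / norm (a \<eta>))"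
  have t: "t > 0" "t\<^sup>2 = norm (b \<eta>) / norm (a \<eta>)" using \<eta> by (simp_all add: t_def)
  define m where "m = t * norm (a \<eta>)"
  have m: "m > 0" "m\<^sup>2 = norm (a \<eta>) * norm (b \<eta>)"
    using \<eta> t by (simp_all add: m_def power_mult_distrib power2_eq_square[of "norm (a \<eta>)"])
  have "cb_norm (jordan_op (t *\<^sub>R a) (inverse t *\<^sub>R b))
      = op_norm (jordan_op (t *\<^sub>R a) (inverse t *\<^sub>R b))"
  proof (rule cb_norm_jordan_op_balanced[OF assms(1)])
    show "t *\<^sub>R a \<in> bounded_ops" "inverse t *\<^sub>R b \<in> bounded_ops"
      using assms(2,3) by (simp_all add: bounded_ops_scaleR)
    show "(t *\<^sub>R a) o\<^sub>L (inverse t *\<^sub>R b) = (inverse t *\<^sub>R b) o\<^sub>L (t *\<^sub>R a)"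
    proof (rule blinfun_eqI)
      show "((t *\<^sub>R a) o\<^sub>L (inverse t *\<^sub>R b)) v = ((inverse t *\<^sub>R b) o\<^sub>L (t *\<^sub>R a)) v" for v
        using arg_cong[OF assms(4), of "\<lambda>c. blinfun_apply c v"] t(1)
        by (simp add: blinfun.bilinear_simps)
    qed
    show "norm ((t *\<^sub>R a) \<eta>) = m"
      using t(1) by (simp add: m_def blinfun.bilinear_simps)
    show "norm ((inverse t *\<^sub>R b) \<eta>) = m"
      using \<eta> t by (simp add: m_def blinfun.bilinear_simps field_simps power2_eq_square)
    show "norm ((t *\<^sub>R a) v) * norm ((inverse t *\<^sub>R b) v) \<le> m\<^sup>2 * (norm v)\<^sup>2" for v
      using \<eta>(4)[of v] t(1) by (simp add: m(2) blinfun.bilinear_simps field_simps)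
  qed (use \<eta> m in auto)
  then show ?thesis using t(1) by (simp add: jordan_op_scaleR)
qed

end
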